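(* Let $\varepsilon>0$, let $(X,d_X)$ and $(Y,d_Y)$ be Polish metric spaces, $c:X\times Y\to\mathbb{R}$ a bounded Borel cost function, $\rho_1\in\mathcal{P}(X)$, $\rho_2\in\mathcal{P}(Y)$ probability measures. Given $u^*\in L^{\exp}_{\varepsilon}(\rho_1)$, $v^*\in L^{\exp}_{\varepsilon}(\rho_2)$, the following are equivalent: 1. (Maximizers) $(u^*,v^* )$ attains $\sup\{D_{\varepsilon}(u,v): u\in L^{\exp}_{\varepsilon}(\rho_1), v\in L^{\exp}_{\varepsilon}(\rho_2)\}$; 2. (Maximality condition) $\mathcal{F}^{(c,\varepsilon)}(u^* )=v^*$ ($\rho_2$-a.e.) and $\mathcal{F}^{(c,\varepsilon)}(v^* )=u^*$ ($\rho_1$-a.e.); 3. (Schrödinger system) the measure $\gamma^*=e^{(u^*(x)+v^*(y)-c(x,y))/\varepsilon}\,\rho_1\otimes\rho_2$ belongs to $\Pi(\rho_1,\rho_2)$; 4. (Duality attainment) $\mathrm{OT}_{\varepsilon}(\rho_1,\rho_2)=D_{\varepsilon}(u^*,v^* )+\varepsilon$. Moreover, in those cases $\gamma^*$, as defined in 3, is also the unique minimizer of the problem $\mathrm{OT}_{\varepsilon}(\rho_1,\rho_2)=\inf_{\gamma\in\Pi(\rho_1,\rho_2)}\varepsilon\,\mathrm{KL}(\gamma|\mathcal{K})$.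
   Context: $L^{\exp}_{\varepsilon}(\rho)$ is the set of measurable functions $u$ with values in $[-\infty,\infty)$ and $0<\int e^{u/\varepsilon}\,d\rho<\infty$. For $u\in L^{\exp}_{\varepsilon}(\rho_1)$, $v\in L^{\exp}_{\varepsilon}(\rho_2)$: $$\mathcal{F}^{(c,\varepsilon)}(u)(y)=-\varepsilon\log\int_X e^{\frac{u(x)-c(x,y)}{\varepsilon}}d\rho_1(x),\qquad \mathcal{F}^{(c,\varepsilon)}(v)(x)=-\varepsilon\log\int_Y e^{\frac{v(y)-c(x,y)}{\varepsilon}}d\rho_2(y),$$ $$D_{\varepsilon}(u,v)=\int_X u\,d\rho_1+\int_Y v\,d\rho_2-\varepsilon\int_{X\times Y}e^{\frac{u(x)+v(y)-c(x,y)}{\varepsilon}}d(\rho_1\otimes\rho_2)\in[-\infty,\infty).$$ $\mathcal{K}=k\,\rho_1\otimes\rho_2$ with $k=e^{-c/\varepsilon}$. $\Pi(\rho_1,\rho_2)$ is the set of probability measures on $X\times Y$ with marginals $\rho_1,\rho_2$. $\mathrm{KL}(\gamma|\mathcal{K})=\int\gamma\log(\gamma/k)\,d(\rho_1\otimes\rho_2)$ if $\gamma\ll\rho_1\otimes\rho_2$ ($\gamma$ also denoting the density), $+\infty$ otherwise. $\mathrm{OT}_{\varepsilon}(\rho_1,\rho_2)=\inf_{\gamma\in\Pi(\rho_1,\rho_2)}\varepsilon\,\mathrm{KL}(\gamma|\mathcal{K})$. *)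

theory Defs
  imports "HOL-Probability.Probability"
begin

definition eexp :: "ereal \<Rightarrow> ennreal" where
  "eexp x = (if x = \<infinity> then \<infinity> else if x = -\<infinity> then 0 else ennreal (exp (real_of_ereal x)))"

definition elog :: "ennreal \<Rightarrow> ereal" where
  "elog x = (if x = 0 then -\<infinity> else if x = \<infinity> then \<infinity> else ereal (ln (enn2real x)))"

text \<open>The Bochner integral returns 0 for non-integrable functions. The integrals below may be
  infinite, so they are taken as the integral of the positive part minus the integral of the
  negative part (\<^const>\<open>e2ennreal\<close> truncates negative values to 0). The value is meaningful when
  at least one of the two is finite: this is so for \<open>\<integral>u d\<rho>\<close> with \<open>u\<close> in \<open>Lexp\<close> and
  \<open>\<rho>\<close> a probability measure, because \<open>u/\<epsilon> \<le> exp(u/\<epsilon>)\<close>, and for the relative entropy of a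
  probability measure when \<open>k = exp(-c/\<epsilon>)\<close> with \<open>c\<close> bounded, because \<open>t log t \<ge> -1/e\<close>.\<close>

definition ext_integral :: "'a measure \<Rightarrow> ('a \<Rightarrow> ereal) \<Rightarrow> ereal" where
  "ext_integral M f =
     enn2ereal (\<integral>\<^sup>+x. e2ennreal (f x) \<partial>M) - enn2ereal (\<integral>\<^sup>+x. e2ennreal (- f x) \<partial>M)"

definition Lexp :: "real \<Rightarrow> 'a measure \<Rightarrow> ('a \<Rightarrow> ereal) set" where
  "Lexp \<epsilon> \<rho> = {u. u \<in> borel_measurable \<rho> \<and> (\<forall>x. u x \<noteq> \<infinity>) \<and>
     0 < (\<integral>\<^sup>+x. eexp (u x / ereal \<epsilon>) \<partial>\<rho>) \<and> (\<integral>\<^sup>+x. eexp (u x / ereal \<epsilon>) \<partial>\<rho>) < \<infinity>}"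

definition transform1 ::
    "real \<Rightarrow> ('a \<times> 'b \<Rightarrow> real) \<Rightarrow> 'a measure \<Rightarrow> ('a \<Rightarrow> ereal) \<Rightarrow> 'b \<Rightarrow> ereal" where
  "transform1 \<epsilon> c \<rho>\<^sub>1 u y =
     - (ereal \<epsilon> * elog (\<integral>\<^sup>+x. eexp ((u x - ereal (c (x, y))) / ereal \<epsilon>) \<partial>\<rho>\<^sub>1))"

definition transform2 ::
    "real \<Rightarrow> ('a \<times> 'b \<Rightarrow> real) \<Rightarrow> 'b measure \<Rightarrow> ('b \<Rightarrow> ereal) \<Rightarrow> 'a \<Rightarrow> ereal" where
  "transform2 \<epsilon> c \<rho>\<^sub>2 v x =
     - (ereal \<epsilon> * elog (\<integral>\<^sup>+y. eexp ((v y - ereal (c (x, y))) / ereal \<epsilon>) \<partial>\<rho>\<^sub>2))"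

definition gibbs_density ::
    "real \<Rightarrow> ('a \<times> 'b \<Rightarrow> real) \<Rightarrow> ('a \<Rightarrow> ereal) \<Rightarrow> ('b \<Rightarrow> ereal) \<Rightarrow> 'a \<times> 'b \<Rightarrow> ennreal" where
  "gibbs_density \<epsilon> c u v = (\<lambda>(x, y). eexp ((u x + v y - ereal (c (x, y))) / ereal \<epsilon>))"

definition dual_functional ::
    "real \<Rightarrow> ('a \<times> 'b \<Rightarrow> real) \<Rightarrow> 'a measure \<Rightarrow> 'b measure \<Rightarrow> ('a \<Rightarrow> ereal) \<Rightarrow> ('b \<Rightarrow> ereal) \<Rightarrow> ereal"
  where
  "dual_functional \<epsilon> c \<rho>\<^sub>1 \<rho>\<^sub>2 u v =
     ext_integral \<rho>\<^sub>1 u + ext_integral \<rho>\<^sub>2 v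
       - ereal \<epsilon> * enn2ereal (\<integral>\<^sup>+z. gibbs_density \<epsilon> c u v z \<partial>(\<rho>\<^sub>1 \<Otimes>\<^sub>M \<rho>\<^sub>2))"

definition couplings ::
    "'a::topological_space measure \<Rightarrow> 'b::topological_space measure \<Rightarrow> ('a \<times> 'b) measure set" where
  "couplings \<rho>\<^sub>1 \<rho>\<^sub>2 = {\<gamma>. prob_space \<gamma> \<and> sets \<gamma> = sets borel \<and>
     distr \<gamma> borel fst = \<rho>\<^sub>1 \<and> distr \<gamma> borel snd = \<rho>\<^sub>2}"

text \<open>\<open>KL R k \<gamma>\<close> is the Kullback-Leibler divergence of \<open>\<gamma>\<close> relative to the measure \<open>k R\<close>, for a
  strictly positive density \<open>k\<close>; the convention \<open>0 log 0 = 0\<close> is automatic. The library's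
  \<open>KL_divergence\<close> is a Bochner integral and therefore is not infinite where it should be.\<close>

definition KL :: "'a measure \<Rightarrow> ('a \<Rightarrow> real) \<Rightarrow> 'a measure \<Rightarrow> ereal" where
  "KL R k \<gamma> =
     (if absolutely_continuous R \<gamma>
      then ext_integral R (\<lambda>z. let g = enn2real (RN_deriv R \<gamma> z) in ereal (g * ln (g / k z)))
      else \<infinity>)"

definition entropic_cost ::
    "real \<Rightarrow> ('a \<times> 'b \<Rightarrow> real) \<Rightarrow> 'a measure \<Rightarrow> 'b measure \<Rightarrow> ('a \<times> 'b) measure \<Rightarrow> ereal" where
  "entropic_cost \<epsilon> c \<rho>\<^sub>1 \<rho>\<^sub>2 \<gamma> = ereal \<epsilon> * KL (\<rho>\<^sub>1 \<Otimes>\<^sub>M \<rho>\<^sub>2) (\<lambda>z. exp (- c z / \<epsilon>)) \<gamma>"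

definition OT ::
    "real \<Rightarrow> ('a::topological_space \<times> 'b::topological_space \<Rightarrow> real) \<Rightarrow> 'a measure \<Rightarrow> 'b measure \<Rightarrow> ereal"
  where
  "OT \<epsilon> c \<rho>\<^sub>1 \<rho>\<^sub>2 = (INF \<gamma>\<in>couplings \<rho>\<^sub>1 \<rho>\<^sub>2. entropic_cost \<epsilon> c \<rho>\<^sub>1 \<rho>\<^sub>2 \<gamma>)"

end

theory Submission
  imports Defs
begin

text \<open>Writing \<open>g\<close> for the density of a coupling \<open>\<gamma>\<close> and \<open>h\<close> for the Gibbs density of potentials
  \<open>(u, v)\<close>, the duality gap \<open>\<epsilon> KL(\<gamma>|K) - D(u, v) - \<epsilon>\<close> is \<open>\<epsilon> \<integral>(g ln (g/h) - g + h)\<close>, hence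
  nonnegative, and zero only if \<open>\<gamma>\<close> is the Gibbs measure. This gives weak duality, and strong duality
  with uniqueness once the Gibbs measure is a coupling. Each marginal condition for the Gibbs measure is
  one of the two transform equations, by Tonelli; since \<open>c\<close> is bounded, these force \<open>u\<close> and \<open>v\<close> to be
  essentially bounded, so that all integrals are finite. A maximizing pair satisfies the transform
  equations because replacing \<open>v\<close> by the transform of \<open>u\<close> increases \<open>D\<close> strictly unless they agree
  a.e.; the other equation follows by exchanging the two factors.\<close>

section \<open>Extended-valued integrals and relative entropy\<close>

lemma eexp_simps [simp]:
  "eexp (ereal r) = ennreal (exp r)" "eexp (-\<infinity>) = 0" "eexp \<infinity> = \<infinity>"
  by (auto simp: eexp_def)

lemma eexp_measurable [measurable]: "eexp \<in> borel_measurable borel"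
  unfolding eexp_def by measurable

lemma eexp_diff_divide:
  assumes "\<epsilon> > 0" "u \<noteq> \<infinity>"
  shows "eexp ((u - ereal r) / ereal \<epsilon>) = eexp (u / ereal \<epsilon>) * ennreal (exp (- r / \<epsilon>))"
  using assms
  by (cases u) (auto simp: ennreal_mult[symmetric] exp_add[symmetric] diff_divide_distrib)

text \<open>The factor in \<open>v\<close> alone can leave an integral over the first variable, and
  what stays behind is the integrand of the partition function. Excluding \<open>\<infinity>\<close>
  rules out the sum of opposite infinities.\<close>

lemma eexp_add_diff_divide:
  assumes "\<epsilon> > 0" "u \<noteq> \<infinity>" "v \<noteq> \<infinity>"
  shows "eexp ((u + v - ereal r) / ereal \<epsilon>) = eexp (v / ereal \<epsilon>) * eexp ((u - ereal r) / ereal \<epsilon>)"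
proof (cases u)
  case u: (real a)
  show ?thesis
  proof (cases v)
    case (real b)
    have "(a + b - r) / \<epsilon> = b / \<epsilon> + (a - r) / \<epsilon>" by (simp add: add_divide_distrib diff_divide_distrib)
    then show ?thesis using real u \<open>\<epsilon> > 0\<close> by (simp add: ennreal_mult[symmetric] exp_add)
  qed (use assms u in auto)
next
  case MInf
  then show ?thesis using assms by (cases v) auto
qed (use assms in auto)

text \<open>Pointwise bridge between the two descriptions of a marginal condition: with
  \<open>z\<close> the value of the partition function, the left side says that the marginal density
  is 1 and the right side is the transform equation. For \<open>v = -\<infinity>\<close> both sides
  fail.\<close>

lemma eexp_times_eq_1_iff:
  assumes "\<epsilon> > 0" "v \<noteq> \<infinity>" "z > 0"
  shows "eexp (v / ereal \<epsilon>) * ennreal z = 1 \<longleftrightarrow> - (ereal \<epsilon> * elog (ennreal z)) = v"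
proof (cases v)
  case (real r)
  have "exp (r / \<epsilon>) * z = 1 \<longleftrightarrow> r / \<epsilon> = - ln z"
  proof -
    have "exp (r / \<epsilon>) * z = exp (r / \<epsilon> + ln z)" using \<open>z > 0\<close> by (simp add: exp_add)
    then show ?thesis by (simp add: eq_neg_iff_add_eq_0)
  qed
  also have "\<dots> \<longleftrightarrow> - (\<epsilon> * ln z) = r"
    using \<open>\<epsilon> > 0\<close> by (auto simp: field_simps)
  finally show ?thesis
    using assms real
    by (auto simp: elog_def ennreal_mult[symmetric] ennreal_eq_1)
qed (use assms in \<open>auto simp: elog_def\<close>)

section \<open>Extended integrals\<close>

lemma ext_integral_cong_AE:
  assumes "AE x in M. f x = g x"
  shows "ext_integral M f = ext_integral M g"
proof -
  have "(\<integral>\<^sup>+x. e2ennreal (f x) \<partial>M) = (\<integral>\<^sup>+x. e2ennreal (g x) \<partial>M)"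
    "(\<integral>\<^sup>+x. e2ennreal (- f x) \<partial>M) = (\<integral>\<^sup>+x. e2ennreal (- g x) \<partial>M)"
    using assms by (auto intro!: nn_integral_cong_AE)
  then show ?thesis by (simp add: ext_integral_def)
qed

lemma ext_integral_ereal:
  assumes "integrable M f"
  shows "ext_integral M (\<lambda>x. ereal (f x)) = ereal (\<integral>x. f x \<partial>M)"
proof -
  have "(\<integral>\<^sup>+x. ennreal (f x) \<partial>M) \<noteq> \<infinity>" "(\<integral>\<^sup>+x. ennreal (- f x) \<partial>M) \<noteq> \<infinity>"
    using assms by (auto simp: real_integrable_def)
  then show ?thesis
    using assms
    by (cases "\<integral>\<^sup>+x. ennreal (f x) \<partial>M" rule: ennreal_cases;
        cases "\<integral>\<^sup>+x. ennreal (- f x) \<partial>M" rule: ennreal_cases)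
       (simp_all add: ext_integral_def real_lebesgue_integral_def)
qed

text \<open>An infinite positive or negative part makes the difference infinite, since
  \<open>\<infinity> - \<infinity>\<close> evaluates to \<open>\<infinity>\<close> in
  \<open>ereal\<close>. A finite value therefore bounds both parts and gives access to the Bochner
  integral.\<close>

lemma ext_integral_finiteD:
  assumes [measurable]: "f \<in> borel_measurable M" and fin: "\<bar>ext_integral M f\<bar> \<noteq> \<infinity>"
  shows "AE x in M. f x = ereal (real_of_ereal (f x))" "integrable M (\<lambda>x. real_of_ereal (f x))"
proof -
  let ?P = "\<integral>\<^sup>+x. e2ennreal (f x) \<partial>M" and ?N = "\<integral>\<^sup>+x. e2ennreal (- f x) \<partial>M"
  have PN: "?P \<noteq> \<infinity>" "?N \<noteq> \<infinity>"
    using fin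
    by (cases ?P rule: ennreal_cases; cases ?N rule: ennreal_cases;
        simp add: ext_integral_def)+
  have "AE x in M. e2ennreal (f x) \<noteq> \<infinity>"
    by (rule nn_integral_PInf_AE) (use PN in auto)
  moreover have "AE x in M. e2ennreal (- f x) \<noteq> \<infinity>"
    by (rule nn_integral_PInf_AE) (use PN in auto)
  ultimately have *: "AE x in M. \<bar>f x\<bar> \<noteq> \<infinity>"
  proof eventually_elim
    case (elim x)
    then show ?case by (cases "f x") auto
  qed
  show "AE x in M. f x = ereal (real_of_ereal (f x))"
    using * by eventually_elim (simp add: ereal_real)
  have "(\<integral>\<^sup>+x. ennreal (real_of_ereal (f x)) \<partial>M) = ?P"
  proof (rule nn_integral_cong_AE, use * in eventually_elim)
    case (elim x)
    then show ?case by (cases "f x") auto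
  qed
  moreover have "(\<integral>\<^sup>+x. ennreal (- real_of_ereal (f x)) \<partial>M) = ?N"
  proof (rule nn_integral_cong_AE, use * in eventually_elim)
    case (elim x)
    then show ?case by (cases "f x") auto
  qed
  ultimately show "integrable M (\<lambda>x. real_of_ereal (f x))"
    using PN by (auto simp: real_integrable_def)
qed

section \<open>Relative entropy through real densities\<close>

text \<open>This is \<open>ln t \<le> t - 1\<close> at \<open>t = h / g\<close>, with equality only
  at \<open>t = 1\<close>; for \<open>g = 0\<close> the inequality is strict because
  \<open>h > 0\<close>. It makes the integrand of the duality gap nonnegative and identifies its
  zeros.\<close>

lemma mult_ln_divide_ge:
  fixes g h :: real
  assumes "g \<ge> 0" "h > 0"
  shows "g - h \<le> g * ln (g / h)"
    and "g * ln (g / h) = g - h \<Longrightarrow> g = h"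
proof -
  have *: "g - h \<le> g * ln (g / h) \<and> (g * ln (g / h) = g - h \<longrightarrow> g = h)"
  proof (cases "g = 0")
    case False
    then have "g > 0" using assms by simp
    have ln: "ln (g / h) = - ln (h / g)"
      using \<open>g > 0\<close> assms by (simp add: ln_div)
    have "ln (h / g) \<le> h / g - 1"
      using \<open>g > 0\<close> assms by (intro ln_le_minus_one) simp
    then have "g * ln (h / g) \<le> g * (h / g - 1)"
      using \<open>g > 0\<close> by (intro mult_left_mono) auto
    moreover have e: "g * (h / g - 1) = h - g" using \<open>g > 0\<close> by (simp add: field_simps)
    moreover have "g = h" if "g * ln (g / h) = g - h"
    proof -
      have "g * ln (h / g) = g * (h / g - 1)" using that e ln by simp
      then have "ln (h / g) = h / g - 1" using \<open>g > 0\<close> by simp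
      then have "h / g = 1" using \<open>g > 0\<close> assms by (intro ln_eq_minus_one) auto
      then show ?thesis using \<open>g > 0\<close> by simp
    qed
    ultimately show ?thesis using ln by auto
  qed (use assms in auto)
  then show "g - h \<le> g * ln (g / h)" "g * ln (g / h) = g - h \<Longrightarrow> g = h" by auto
qed

text \<open>The negative part of the entropy integrand is dominated by the integrable
  \<open>k\<close>, so only the positive part can diverge. Finite entropy is thus a genuine Bochner
  integral of a real density.\<close>

lemma (in sigma_finite_measure) KL_finiteD:
  assumes \<gamma>: "finite_measure \<gamma>" "sets \<gamma> = sets M"
    and k: "integrable M k" "\<And>x. k x > 0" and fin: "KL M k \<gamma> \<noteq> \<infinity>"
  obtains g where "g \<in> borel_measurable M" "\<And>x. g x \<ge> (0::real)" "\<gamma> = density M (\<lambda>x. ennreal (g x))"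
    "integrable M (\<lambda>x. g x * ln (g x / k x))" "KL M k \<gamma> = ereal (\<integral>x. g x * ln (g x / k x) \<partial>M)"
proof -
  interpret \<gamma>: finite_measure \<gamma> by fact
  note [measurable] = borel_measurable_integrable[OF k(1)]
  have ac: "absolutely_continuous M \<gamma>"
    using fin by (auto simp: KL_def split: if_splits)
  define g where "g x = enn2real (RN_deriv M \<gamma> x)" for x
  have [measurable]: "g \<in> borel_measurable M" by (simp add: g_def[abs_def])
  \<comment> \<open>Since \<open>\<gamma>\<close> is finite, its density is finite a.e., and passing
    through \<open>enn2real\<close> alters it only on a null set.\<close>
  have "AE x in M. RN_deriv M \<gamma> x \<noteq> \<infinity>"
    by (rule RN_deriv_finite) (use ac \<gamma> in \<open>auto intro: \<gamma>.sigma_finite_measure_axioms\<close>)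
  then have "density M (\<lambda>x. ennreal (g x)) = density M (RN_deriv M \<gamma>)"
    by (intro density_cong) (auto simp: g_def less_top elim!: eventually_mono)
  then have dens: "\<gamma> = density M (\<lambda>x. ennreal (g x))"
    using density_RN_deriv[OF ac \<gamma>(2)] by simp
  let ?\<phi> = "\<lambda>x. g x * ln (g x / k x)"
  have KL: "KL M k \<gamma> = ext_integral M (\<lambda>x. ereal (?\<phi> x))"
    using ac by (simp add: KL_def g_def Let_def)
  have "(\<integral>\<^sup>+x. ennreal (- ?\<phi> x) \<partial>M) \<le> (\<integral>\<^sup>+x. ennreal (k x) \<partial>M)"
  proof (intro nn_integral_mono ennreal_leI)
    fix x
    have "0 \<le> g x" by (simp add: g_def)
    then show "- ?\<phi> x \<le> k x" using mult_ln_divide_ge(1)[OF _ k(2)[of x], of "g x"] by linarith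
  qed
  also have "\<dots> < \<infinity>" using k(1) by (auto simp: real_integrable_def less_top)
  finally have N: "(\<integral>\<^sup>+x. ennreal (- ?\<phi> x) \<partial>M) < \<infinity>" .
  have "(\<integral>\<^sup>+x. ennreal (?\<phi> x) \<partial>M) \<noteq> \<infinity>"
    using fin N unfolding KL
    by (cases "\<integral>\<^sup>+x. ennreal (- ?\<phi> x) \<partial>M" rule: ennreal_cases)
       (auto simp: ext_integral_def)
  then have int: "integrable M ?\<phi>"
    using N by (auto simp: real_integrable_def)
  show thesis
    by (rule that[of g]) (use dens int KL ext_integral_ereal[OF int] in \<open>auto simp: g_def\<close>)
qed

text \<open>Radon-Nikodym derivatives are unique a.e., so the entropy may be computed from any given
  density instead of the chosen derivative.\<close>

lemma (in sigma_finite_measure) KL_density: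
  assumes [measurable]: "g \<in> borel_measurable M" and g: "\<And>x. g x \<ge> (0::real)"
    and int: "integrable M (\<lambda>x. g x * ln (g x / k x))"
  shows "KL M k (density M (\<lambda>x. ennreal (g x))) = ereal (\<integral>x. g x * ln (g x / k x) \<partial>M)"
proof -
  have ac: "absolutely_continuous M (density M (\<lambda>x. ennreal (g x)))"
    by (intro absolutely_continuousI_density) simp
  have "AE x in M. ennreal (g x) = RN_deriv M (density M (\<lambda>x. ennreal (g x))) x"
    by (rule RN_deriv_unique) simp_all
  then have "AE x in M. enn2real (RN_deriv M (density M (\<lambda>x. ennreal (g x))) x) = g x"
  proof eventually_elim
    case (elim x)
    show ?case by (simp flip: elim add: g)
  qed
  then have "ext_integral M (\<lambda>x. let g = enn2real (RN_deriv M (density M (\<lambda>x. ennreal (g x))) x)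
      in ereal (g * ln (g / k x))) = ext_integral M (\<lambda>x. ereal (g x * ln (g x / k x)))"
    by (intro ext_integral_cong_AE) (auto simp: Let_def elim!: eventually_mono)
  then show ?thesis
    using ac ext_integral_ereal[OF int] by (simp add: KL_def)
qed

section \<open>Potentials with finite exponential moment\<close>

text \<open>Since \<open>t \<le> exp t\<close> at \<open>t = u / \<epsilon>\<close>, the positive
  part of \<open>u\<close> is at most \<open>\<epsilon>\<close> times the exponential whose integral
  is finite.\<close>

lemma ext_integral_Lexp_less_top:
  assumes "\<epsilon> > 0" "u \<in> Lexp \<epsilon> M"
  shows "ext_integral M u < \<infinity>"
proof -
  have [measurable]: "u \<in> borel_measurable M" and u: "\<And>x. u x \<noteq> \<infinity>"
    and fin: "(\<integral>\<^sup>+x. eexp (u x / ereal \<epsilon>) \<partial>M) < \<infinity>"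
    using assms by (auto simp: Lexp_def)
  have "(\<integral>\<^sup>+x. e2ennreal (u x) \<partial>M) \<le> (\<integral>\<^sup>+x. ennreal \<epsilon> * eexp (u x / ereal \<epsilon>) \<partial>M)"
  proof (rule nn_integral_mono)
    fix x
    show "e2ennreal (u x) \<le> ennreal \<epsilon> * eexp (u x / ereal \<epsilon>)"
    proof (cases "u x")
      case (real r)
      have "r / \<epsilon> \<le> exp (r / \<epsilon>)" using exp_ge_add_one_self[of "r / \<epsilon>"] by linarith
      then have "r \<le> \<epsilon> * exp (r / \<epsilon>)" using \<open>\<epsilon> > 0\<close> by (simp add: field_simps)
      then show ?thesis
        using \<open>\<epsilon> > 0\<close> real by (simp add: ennreal_mult[symmetric] ennreal_leI)
    qed (use u in \<open>auto simp: e2ennreal_neg\<close>)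
  qed
  also have "\<dots> = ennreal \<epsilon> * (\<integral>\<^sup>+x. eexp (u x / ereal \<epsilon>) \<partial>M)"
    by (rule nn_integral_cmult) measurable
  also have "\<dots> < \<infinity>" using fin by (simp add: ennreal_mult_less_top)
  finally have "(\<integral>\<^sup>+x. e2ennreal (u x) \<partial>M) < \<infinity>" .
  then show ?thesis
    by (cases "\<integral>\<^sup>+x. e2ennreal (u x) \<partial>M" rule: ennreal_cases;
        cases "\<integral>\<^sup>+x. e2ennreal (- u x) \<partial>M" rule: ennreal_cases)
       (auto simp: ext_integral_def)
qed

text \<open>Admits the zero potentials and the transforms as competitors in the dual
  problem.\<close>

lemma (in prob_space) bounded_in_Lexp:
  fixes f :: "'a \<Rightarrow> real"
  assumes [measurable]: "f \<in> borel_measurable M" and "\<epsilon> > 0" and b: "\<And>x. \<bar>f x\<bar> \<le> B"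
  shows "(\<lambda>x. ereal (f x)) \<in> Lexp \<epsilon> M"
proof -
  have fb: "- B \<le> f x" "f x \<le> B" for x using b[of x] by auto
  have "0 < (\<integral>\<^sup>+x. ennreal (exp (- B / \<epsilon>)) \<partial>M)" by (simp add: emeasure_space_1)
  also have "\<dots> \<le> (\<integral>\<^sup>+x. ennreal (exp (f x / \<epsilon>)) \<partial>M)"
    using divide_right_mono[OF fb(1)] \<open>\<epsilon> > 0\<close> by (intro nn_integral_mono ennreal_leI) simp
  finally have 1: "0 < (\<integral>\<^sup>+x. ennreal (exp (f x / \<epsilon>)) \<partial>M)" .
  have "(\<integral>\<^sup>+x. ennreal (exp (f x / \<epsilon>)) \<partial>M) \<le> (\<integral>\<^sup>+x. ennreal (exp (B / \<epsilon>)) \<partial>M)"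
    using fb \<open>\<epsilon> > 0\<close> by (intro nn_integral_mono ennreal_leI) (simp add: divide_right_mono)
  also have "\<dots> < \<infinity>" by (simp add: emeasure_space_1)
  finally show ?thesis using 1 \<open>\<epsilon> > 0\<close> by (simp add: Lexp_def)
qed

section \<open>Gibbs measures and their marginals\<close>

lemma swap_measurable [measurable]: "prod.swap \<in> measurable (M \<Otimes>\<^sub>M N) (N \<Otimes>\<^sub>M M)"
  unfolding prod.swap_def[abs_def] by measurable

text \<open>The hypotheses form a locale so that they can be instantiated again with the two factors
  exchanged; each statement about the second marginal then yields its counterpart for the
  first.\<close>

locale entropic_transport =
  fixes \<epsilon> :: real
    and c :: "'a::polish_space \<times> 'b::polish_space \<Rightarrow> real"
    and \<rho>\<^sub>1 :: "'a measure" and \<rho>\<^sub>2 :: "'b measure"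
  assumes eps_pos: "\<epsilon> > 0"
    and c_borel: "c \<in> borel_measurable borel" and c_bounded: "bounded (range c)"
    and prob1: "prob_space \<rho>\<^sub>1" and sets1 [measurable_cong]: "sets \<rho>\<^sub>1 = sets borel"
    and prob2: "prob_space \<rho>\<^sub>2" and sets2 [measurable_cong]: "sets \<rho>\<^sub>2 = sets borel"
begin

sublocale M1: prob_space \<rho>\<^sub>1 by (rule prob1)
sublocale M2: prob_space \<rho>\<^sub>2 by (rule prob2)
sublocale pair_prob_space \<rho>\<^sub>1 \<rho>\<^sub>2 ..

abbreviation "R \<equiv> \<rho>\<^sub>1 \<Otimes>\<^sub>M \<rho>\<^sub>2"

lemma sets_R: "sets R = sets borel"
  by (simp add: borel_prod[symmetric] sets1 sets2 cong: sets_pair_measure_cong)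

lemma c_measurable [measurable]: "c \<in> borel_measurable (borel \<Otimes>\<^sub>M borel)"
  using c_borel by (simp add: borel_prod)

lemma entropic_transport_swap: "entropic_transport \<epsilon> (c \<circ> prod.swap) \<rho>\<^sub>2 \<rho>\<^sub>1"
proof
  have "c \<circ> prod.swap \<in> borel_measurable (borel \<Otimes>\<^sub>M borel)"
    by (simp add: prod.swap_def comp_def)
  then show "c \<circ> prod.swap \<in> borel_measurable borel" by (simp add: borel_prod)
  show "bounded (range (c \<circ> prod.swap))"
    using c_bounded by (rule bounded_subset) auto
qed (use eps_pos prob1 prob2 sets1 sets2 in auto)

lemma LexpD:
  assumes "u \<in> Lexp \<epsilon> M"
  shows "u \<in> borel_measurable M" "u x \<noteq> \<infinity>" "0 < (\<integral>\<^sup>+x. eexp (u x / ereal \<epsilon>) \<partial>M)"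
    "(\<integral>\<^sup>+x. eexp (u x / ereal \<epsilon>) \<partial>M) < \<infinity>"
  using assms by (auto simp: Lexp_def)

text \<open>The transform of \<open>u\<close> is \<open>- \<epsilon>\<close> times the logarithm of
  this function. Keeping it in \<open>ennreal\<close> lets it appear inside nonnegative integrals,
  where Tonelli applies.\<close>

definition partition_function :: "('a \<Rightarrow> ereal) \<Rightarrow> 'b \<Rightarrow> ennreal" where
  "partition_function u y = (\<integral>\<^sup>+x. eexp ((u x - ereal (c (x, y))) / ereal \<epsilon>) \<partial>\<rho>\<^sub>1)"

lemma partition_function_measurable [measurable]:
  assumes [measurable]: "u \<in> borel_measurable \<rho>\<^sub>1"
  shows "partition_function u \<in> borel_measurable borel"
  unfolding partition_function_def[abs_def] by measurable

text \<open>With \<open>\<bar>c\<bar> \<le> C\<close> the kernel lies between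
  \<open>exp (- C / \<epsilon>)\<close> and \<open>exp (C / \<epsilon>)\<close>, so the partition
  function is the exponential integral of \<open>u\<close> up to these factors, uniformly in
  \<open>y\<close>.\<close>

lemma partition_function_bounds:
  assumes u: "u \<in> Lexp \<epsilon> \<rho>\<^sub>1"
  obtains l h :: real where "0 < l" "\<And>y. ennreal l \<le> partition_function u y" "\<And>y. partition_function u y \<le> ennreal h"
proof -
  note [measurable] = LexpD(1)[OF u]
  obtain C where C: "\<bar>c z\<bar> \<le> C" for z
    using c_bounded by (auto simp: bounded_iff)
  obtain r where r: "(\<integral>\<^sup>+x. eexp (u x / ereal \<epsilon>) \<partial>\<rho>\<^sub>1) = ennreal r" "r > 0"
    using LexpD(3,4)[OF u] by (cases "\<integral>\<^sup>+x. eexp (u x / ereal \<epsilon>) \<partial>\<rho>\<^sub>1" rule: ennreal_cases) auto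
  have eq: "partition_function u y = (\<integral>\<^sup>+x. eexp (u x / ereal \<epsilon>) * ennreal (exp (- c (x, y) / \<epsilon>)) \<partial>\<rho>\<^sub>1)" for y
    unfolding partition_function_def using eps_pos LexpD(2)[OF u] by (simp add: eexp_diff_divide)
  have int: "(\<integral>\<^sup>+x. eexp (u x / ereal \<epsilon>) * ennreal (exp t) \<partial>\<rho>\<^sub>1) = ennreal (r * exp t)" for t
    using r by (subst nn_integral_multc) (auto simp: ennreal_mult)
  have "- C \<le> - c z" "- c z \<le> C" for z using C[of z] by auto
  note cb = this[THEN divide_right_mono, of \<epsilon>]
  show thesis
  proof
    show "0 < r * exp (- C / \<epsilon>)" using r by simp
    show "ennreal (r * exp (- C / \<epsilon>)) \<le> partition_function u y" for y
      unfolding eq int[symmetric] using cb eps_pos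
      by (intro nn_integral_mono mult_left_mono ennreal_leI) auto
    show "partition_function u y \<le> ennreal (r * exp (C / \<epsilon>))" for y
      unfolding eq int[symmetric] using cb eps_pos
      by (intro nn_integral_mono mult_left_mono ennreal_leI) auto
  qed
qed

text \<open>Between positive constants the logarithm is bounded. Hence the transform is a bounded
  Borel function, even where \<open>u\<close> itself is unbounded or
  \<open>-\<infinity>\<close>.\<close>

lemma transform1_real:
  assumes u: "u \<in> Lexp \<epsilon> \<rho>\<^sub>1"
  obtains f B where "f \<in> borel_measurable borel" "\<And>y. \<bar>f y\<bar> \<le> (B::real)"
    "\<And>y. partition_function u y = ennreal (exp (- f y / \<epsilon>))" "\<And>y. transform1 \<epsilon> c \<rho>\<^sub>1 u y = ereal (f y)"
proof -
  note [measurable] = LexpD(1)[OF u]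
  obtain l h :: real where lh: "0 < l" "\<And>y. ennreal l \<le> partition_function u y" "\<And>y. partition_function u y \<le> ennreal h"
    by (rule partition_function_bounds[OF u]) blast
  define p where "p y = enn2real (partition_function u y)" for y
  have [measurable]: "p \<in> borel_measurable borel" by (simp add: p_def[abs_def])
  have p: "partition_function u y = ennreal (p y)" for y
    using le_less_trans[OF lh(3) ennreal_less_top] by (simp add: p_def)
  have pl: "l \<le> p y" for y
    using lh(2)[of y] \<open>0 < l\<close> unfolding p by (simp add: p_def)
  have ph: "p y \<le> h" for y
    using lh(3)[of y] pl[of y] \<open>0 < l\<close> unfolding p by (simp add: ennreal_le_iff2)
  have p0: "p y > 0" for y using pl[of y] \<open>0 < l\<close> by simp
  show thesis
  \<comment> \<open>The signs of \<open>ln l\<close> and \<open>ln h\<close> are unknown, hence the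
    sum of their absolute values as a bound for \<open>ln p\<close>.\<close>
  proof (rule that[of "\<lambda>y. - \<epsilon> * ln (p y)" "\<epsilon> * (\<bar>ln l\<bar> + \<bar>ln h\<bar>)"])
    fix y
    have "ln l \<le> ln (p y)" "ln (p y) \<le> ln h"
      using pl[of y] ph[of y] p0[of y] \<open>0 < l\<close> by simp_all
    then have "\<bar>ln (p y)\<bar> \<le> \<bar>ln l\<bar> + \<bar>ln h\<bar>" by linarith
    then show "\<bar>- \<epsilon> * ln (p y)\<bar> \<le> \<epsilon> * (\<bar>ln l\<bar> + \<bar>ln h\<bar>)"
      using eps_pos by (simp add: abs_mult)
    show "partition_function u y = ennreal (exp (- (- \<epsilon> * ln (p y)) / \<epsilon>))"
      using eps_pos p0[of y] p[of y] by simp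
    show "transform1 \<epsilon> c \<rho>\<^sub>1 u y = ereal (- \<epsilon> * ln (p y))"
      using p0[of y] p[of y] by (simp add: transform1_def elog_def flip: partition_function_def)
  qed measurable
qed

section \<open>Mass and marginals of the Gibbs measure\<close>

lemma gibbs_density_factor:
  assumes "u \<in> Lexp \<epsilon> \<rho>\<^sub>1" "v \<in> Lexp \<epsilon> \<rho>\<^sub>2"
  shows "gibbs_density \<epsilon> c u v (x, y)
    = eexp (v y / ereal \<epsilon>) * eexp ((u x - ereal (c (x, y))) / ereal \<epsilon>)"
  using assms eps_pos by (auto simp: gibbs_density_def eexp_add_diff_divide LexpD)

lemma gibbs_density_measurable [measurable]:
  assumes [measurable]: "u \<in> borel_measurable \<rho>\<^sub>1" "v \<in> borel_measurable \<rho>\<^sub>2"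
  shows "gibbs_density \<epsilon> c u v \<in> borel_measurable R"
  unfolding gibbs_density_def by measurable

text \<open>Tonelli, integrating first over \<open>x\<close>. The test function
  \<open>\<phi>\<close> is later the constant 1, giving the total mass, or an indicator, giving the
  marginal.\<close>

lemma nn_integral_gibbs_snd:
  assumes u: "u \<in> Lexp \<epsilon> \<rho>\<^sub>1" and v: "v \<in> Lexp \<epsilon> \<rho>\<^sub>2" and [measurable]: "\<phi> \<in> borel_measurable borel"
  shows "(\<integral>\<^sup>+z. gibbs_density \<epsilon> c u v z * \<phi> (snd z) \<partial>R)
    = (\<integral>\<^sup>+y. eexp (v y / ereal \<epsilon>) * partition_function u y * \<phi> y \<partial>\<rho>\<^sub>2)"
proof -
  note [measurable] = LexpD(1)[OF u] LexpD(1)[OF v]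
  have "(\<integral>\<^sup>+z. gibbs_density \<epsilon> c u v z * \<phi> (snd z) \<partial>R)
      = (\<integral>\<^sup>+y. \<integral>\<^sup>+x. gibbs_density \<epsilon> c u v (x, y) * \<phi> y \<partial>\<rho>\<^sub>1 \<partial>\<rho>\<^sub>2)"
    by (subst nn_integral_snd[symmetric]) auto
  also have "\<dots> = (\<integral>\<^sup>+y. eexp (v y / ereal \<epsilon>) * partition_function u y * \<phi> y \<partial>\<rho>\<^sub>2)"
    by (intro nn_integral_cong)
       (simp add: gibbs_density_factor[OF u v] nn_integral_multc nn_integral_cmult partition_function_def)
  finally show ?thesis .
qed

lemma nn_integral_gibbs:
  assumes u: "u \<in> Lexp \<epsilon> \<rho>\<^sub>1" and v: "v \<in> Lexp \<epsilon> \<rho>\<^sub>2"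
  shows "(\<integral>\<^sup>+z. gibbs_density \<epsilon> c u v z \<partial>R) = (\<integral>\<^sup>+y. eexp (v y / ereal \<epsilon>) * partition_function u y \<partial>\<rho>\<^sub>2)"
  using nn_integral_gibbs_snd[OF u v, of "\<lambda>_. 1"] by simp

text \<open>The partition function of \<open>u\<close> is bounded and \<open>v\<close> has a finite
  exponential integral. The term subtracted in the dual functional is thus always finite.\<close>

lemma nn_integral_gibbs_less_top:
  assumes u: "u \<in> Lexp \<epsilon> \<rho>\<^sub>1" and v: "v \<in> Lexp \<epsilon> \<rho>\<^sub>2"
  shows "(\<integral>\<^sup>+z. gibbs_density \<epsilon> c u v z \<partial>R) < \<infinity>"
proof -
  note [measurable] = LexpD(1)[OF u] LexpD(1)[OF v]
  obtain h :: real where h: "\<And>y. partition_function u y \<le> ennreal h"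
    by (rule partition_function_bounds[OF u]) blast
  have "(\<integral>\<^sup>+z. gibbs_density \<epsilon> c u v z \<partial>R) \<le> (\<integral>\<^sup>+y. eexp (v y / ereal \<epsilon>) * ennreal h \<partial>\<rho>\<^sub>2)"
    unfolding nn_integral_gibbs[OF u v] by (intro nn_integral_mono mult_left_mono h) auto
  also have "\<dots> < \<infinity>"
    using LexpD(4)[OF v] by (subst nn_integral_multc) (auto simp: ennreal_mult_less_top)
  finally show ?thesis .
qed

lemma snd_marginal_gibbs:
  assumes u: "u \<in> Lexp \<epsilon> \<rho>\<^sub>1" and v: "v \<in> Lexp \<epsilon> \<rho>\<^sub>2"
  shows "distr (density R (gibbs_density \<epsilon> c u v)) borel snd
    = density \<rho>\<^sub>2 (\<lambda>y. eexp (v y / ereal \<epsilon>) * partition_function u y)"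
proof (rule measure_eqI)
  note [measurable] = LexpD(1)[OF u] LexpD(1)[OF v]
  fix A assume "A \<in> sets (distr (density R (gibbs_density \<epsilon> c u v)) borel snd)"
  then have [measurable]: "A \<in> sets borel" by simp
  have "emeasure (distr (density R (gibbs_density \<epsilon> c u v)) borel snd) A
      = (\<integral>\<^sup>+z. gibbs_density \<epsilon> c u v z * indicator (snd -` A \<inter> space R) z \<partial>R)"
    by (subst emeasure_distr) (auto simp: emeasure_density)
  also have "\<dots> = (\<integral>\<^sup>+z. gibbs_density \<epsilon> c u v z * indicator A (snd z) \<partial>R)"
    by (intro nn_integral_cong) (auto simp: indicator_def)
  also have "\<dots> = emeasure (density \<rho>\<^sub>2 (\<lambda>y. eexp (v y / ereal \<epsilon>) * partition_function u y)) A"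
    by (subst nn_integral_gibbs_snd[OF u v]) (auto simp: emeasure_density)
  finally show "emeasure (distr (density R (gibbs_density \<epsilon> c u v)) borel snd) A
    = emeasure (density \<rho>\<^sub>2 (\<lambda>y. eexp (v y / ereal \<epsilon>) * partition_function u y)) A" .
qed (simp add: sets2)

text \<open>The marginal has density \<open>eexp (v / \<epsilon>)\<close> times the partition
  function; by uniqueness of densities this must be 1 a.e., and solving for \<open>v\<close> gives
  the transform.\<close>

lemma snd_marginal_iff:
  assumes u: "u \<in> Lexp \<epsilon> \<rho>\<^sub>1" and v: "v \<in> Lexp \<epsilon> \<rho>\<^sub>2"
  shows "distr (density R (gibbs_density \<epsilon> c u v)) borel snd = \<rho>\<^sub>2
    \<longleftrightarrow> (AE y in \<rho>\<^sub>2. transform1 \<epsilon> c \<rho>\<^sub>1 u y = v y)"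
proof -
  note [measurable] = LexpD(1)[OF u] LexpD(1)[OF v]
  obtain f where f: "\<And>y. partition_function u y = ennreal (exp (- f y / \<epsilon>))"
    by (rule transform1_real[OF u]) blast
  have "distr (density R (gibbs_density \<epsilon> c u v)) borel snd = \<rho>\<^sub>2
    \<longleftrightarrow> density \<rho>\<^sub>2 (\<lambda>y. eexp (v y / ereal \<epsilon>) * partition_function u y) = density \<rho>\<^sub>2 (\<lambda>_. 1)"
    by (simp add: snd_marginal_gibbs[OF u v] density_1)
  also have "\<dots> \<longleftrightarrow> (AE y in \<rho>\<^sub>2. eexp (v y / ereal \<epsilon>) * partition_function u y = 1)"
    by (rule M2.density_unique_iff) measurable
  also have "\<dots> \<longleftrightarrow> (AE y in \<rho>\<^sub>2. transform1 \<epsilon> c \<rho>\<^sub>1 u y = v y)"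
    using eexp_times_eq_1_iff[OF eps_pos LexpD(2)[OF v] exp_gt_zero]
    by (simp add: transform1_def f flip: partition_function_def)
  finally show ?thesis .
qed

section \<open>Exchange of the two factors\<close>

lemma transform1_swap: "transform1 \<epsilon> (c \<circ> prod.swap) \<rho>\<^sub>2 v = transform2 \<epsilon> c \<rho>\<^sub>2 v"
  by (simp add: fun_eq_iff transform1_def transform2_def)

lemma gibbs_density_swap: "gibbs_density \<epsilon> (c \<circ> prod.swap) v u = gibbs_density \<epsilon> c u v \<circ> prod.swap"
  by (auto simp: gibbs_density_def add.commute)

lemma R_swap: "R = distr (\<rho>\<^sub>2 \<Otimes>\<^sub>M \<rho>\<^sub>1) R prod.swap"
  using distr_pair_swap by (simp add: prod.swap_def case_prod_beta' cong: distr_cong)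

text \<open>Pushing forward along the swap turns the first marginal into the second marginal of the
  exchanged problem.\<close>

lemma fst_marginal_iff:
  assumes u: "u \<in> Lexp \<epsilon> \<rho>\<^sub>1" and v: "v \<in> Lexp \<epsilon> \<rho>\<^sub>2"
  shows "distr (density R (gibbs_density \<epsilon> c u v)) borel fst = \<rho>\<^sub>1
    \<longleftrightarrow> (AE x in \<rho>\<^sub>1. transform2 \<epsilon> c \<rho>\<^sub>2 v x = u x)"
proof -
  interpret S: entropic_transport \<epsilon> "c \<circ> prod.swap" \<rho>\<^sub>2 \<rho>\<^sub>1 by (rule entropic_transport_swap)
  note [measurable] = LexpD(1)[OF u] LexpD(1)[OF v]
  have "distr (density R (gibbs_density \<epsilon> c u v)) borel fst
      = distr (distr (density S.R (\<lambda>z. gibbs_density \<epsilon> c u v (prod.swap z))) R prod.swap) borel fst"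
    by (subst R_swap, subst density_distr) auto
  also have "\<dots> = distr (density S.R (gibbs_density \<epsilon> (c \<circ> prod.swap) v u)) borel snd"
    by (subst distr_distr) (simp_all only: gibbs_density_swap, simp_all add: comp_def)
  finally show ?thesis
    using S.snd_marginal_iff[OF v u] by (simp add: transform1_swap)
qed

lemma dual_functional_swap:
  assumes u: "u \<in> Lexp \<epsilon> \<rho>\<^sub>1" and v: "v \<in> Lexp \<epsilon> \<rho>\<^sub>2"
  shows "dual_functional \<epsilon> (c \<circ> prod.swap) \<rho>\<^sub>2 \<rho>\<^sub>1 v u = dual_functional \<epsilon> c \<rho>\<^sub>1 \<rho>\<^sub>2 u v"
proof -
  note [measurable] = LexpD(1)[OF u] LexpD(1)[OF v]
  have "(\<integral>\<^sup>+z. gibbs_density \<epsilon> c u v z \<partial>R) = (\<integral>\<^sup>+z. gibbs_density \<epsilon> c u v (prod.swap z) \<partial>(\<rho>\<^sub>2 \<Otimes>\<^sub>M \<rho>\<^sub>1))"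
    by (subst R_swap, subst nn_integral_distr) auto
  then show ?thesis
    by (simp add: dual_functional_def gibbs_density_swap add.commute)
qed

lemma gibbs_coupling_iff:
  assumes u: "u \<in> Lexp \<epsilon> \<rho>\<^sub>1" and v: "v \<in> Lexp \<epsilon> \<rho>\<^sub>2"
  shows "density R (gibbs_density \<epsilon> c u v) \<in> couplings \<rho>\<^sub>1 \<rho>\<^sub>2 \<longleftrightarrow>
    (AE y in \<rho>\<^sub>2. transform1 \<epsilon> c \<rho>\<^sub>1 u y = v y) \<and> (AE x in \<rho>\<^sub>1. transform2 \<epsilon> c \<rho>\<^sub>2 v x = u x)"
proof -
  \<comment> \<open>Total mass 1 is inherited from a marginal, because a push-forward preserves
    mass.\<close>
  have "prob_space (density R (gibbs_density \<epsilon> c u v))"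
    if "distr (density R (gibbs_density \<epsilon> c u v)) borel snd = \<rho>\<^sub>2"
    by (rule prob_space_distrD[of snd _ borel]) (simp_all add: that prob2)
  then show ?thesis
    using fst_marginal_iff[OF u v] snd_marginal_iff[OF u v] by (auto simp: couplings_def sets_R)
qed

section \<open>Duality\<close>

text \<open>Lifts statements that hold a.e. on one factor to the product.\<close>

lemma distr_R_fst: "distr R \<rho>\<^sub>1 fst = \<rho>\<^sub>1"
  by (rule M2.distr_pair_fst)

lemma distr_R_snd: "distr R \<rho>\<^sub>2 snd = \<rho>\<^sub>2"
proof -
  have "distr R \<rho>\<^sub>2 snd = distr (\<rho>\<^sub>2 \<Otimes>\<^sub>M \<rho>\<^sub>1) \<rho>\<^sub>2 fst"
    by (subst R_swap, subst distr_distr) (simp_all add: comp_def)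
  then show ?thesis by (simp add: M1.distr_pair_fst)
qed

text \<open>The potentials may equal \<open>-\<infinity>\<close> on null sets. Replacing them by
  integrable real representatives \<open>a\<close> and \<open>b\<close> reduces the dual functional
  to real arithmetic.\<close>

lemma dual_functional_real:
  assumes u: "u \<in> Lexp \<epsilon> \<rho>\<^sub>1" and v: "v \<in> Lexp \<epsilon> \<rho>\<^sub>2"
    and a: "integrable \<rho>\<^sub>1 a" and b: "integrable \<rho>\<^sub>2 b"
    and ua: "AE x in \<rho>\<^sub>1. u x = ereal (a x)" and vb: "AE y in \<rho>\<^sub>2. v y = ereal (b y)"
  defines "h \<equiv> \<lambda>z. exp ((a (fst z) + b (snd z) - c z) / \<epsilon>)"
  shows "AE z in R. gibbs_density \<epsilon> c u v z = ennreal (h z)" "integrable R h"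
    "dual_functional \<epsilon> c \<rho>\<^sub>1 \<rho>\<^sub>2 u v
      = ereal ((\<integral>x. a x \<partial>\<rho>\<^sub>1) + (\<integral>y. b y \<partial>\<rho>\<^sub>2) - \<epsilon> * (\<integral>z. h z \<partial>R))"
proof -
  note [measurable] = borel_measurable_integrable[OF a] borel_measurable_integrable[OF b]
  have [measurable]: "h \<in> borel_measurable R" unfolding h_def by measurable
  have "AE z in R. u (fst z) = ereal (a (fst z))"
    by (rule AE_distrD[OF measurable_fst]) (unfold distr_R_fst, rule ua)
  moreover have "AE z in R. v (snd z) = ereal (b (snd z))"
    by (rule AE_distrD[OF measurable_snd]) (unfold distr_R_snd, rule vb)
  ultimately show eq: "AE z in R. gibbs_density \<epsilon> c u v z = ennreal (h z)"
    by eventually_elim (use eps_pos in \<open>auto simp: gibbs_density_def h_def split: prod.splits\<close>)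
  then have int: "(\<integral>\<^sup>+z. ennreal (h z) \<partial>R) = (\<integral>\<^sup>+z. gibbs_density \<epsilon> c u v z \<partial>R)"
    by (intro nn_integral_cong_AE) auto
  have h0: "h z \<ge> 0" for z by (simp add: h_def)
  show hi: "integrable R h"
    using nn_integral_gibbs_less_top[OF u v] h0 by (intro integrableI_nonneg) (auto simp: int)
  have H: "(\<integral>\<^sup>+z. gibbs_density \<epsilon> c u v z \<partial>R) = ennreal (\<integral>z. h z \<partial>R)"
    unfolding int[symmetric] by (rule nn_integral_eq_integral[OF hi]) (simp add: h_def)
  have "0 \<le> (\<integral>z. h z \<partial>R)" by (simp add: h_def)
  then show "dual_functional \<epsilon> c \<rho>\<^sub>1 \<rho>\<^sub>2 u v
      = ereal ((\<integral>x. a x \<partial>\<rho>\<^sub>1) + (\<integral>y. b y \<partial>\<rho>\<^sub>2) - \<epsilon> * (\<integral>z. h z \<partial>R))"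
    by (simp add: dual_functional_def H ext_integral_cong_AE[OF ua] ext_integral_cong_AE[OF vb]
        ext_integral_ereal[OF a] ext_integral_ereal[OF b])
qed

text \<open>Neither potential has integral \<open>\<infinity>\<close> and the Gibbs mass is finite,
  so a value above \<open>-\<infinity>\<close> forces both integrals to be finite.\<close>

lemma dual_functional_finiteD:
  assumes u: "u \<in> Lexp \<epsilon> \<rho>\<^sub>1" and v: "v \<in> Lexp \<epsilon> \<rho>\<^sub>2"
    and fin: "dual_functional \<epsilon> c \<rho>\<^sub>1 \<rho>\<^sub>2 u v \<noteq> -\<infinity>"
  obtains a b :: "_ \<Rightarrow> real" where "integrable \<rho>\<^sub>1 a" "integrable \<rho>\<^sub>2 b"
    "AE x in \<rho>\<^sub>1. u x = ereal (a x)" "AE y in \<rho>\<^sub>2. v y = ereal (b y)"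
proof -
  have top: "ext_integral \<rho>\<^sub>1 u < \<infinity>" "ext_integral \<rho>\<^sub>2 v < \<infinity>"
    by (rule ext_integral_Lexp_less_top[OF eps_pos] u v)+
  obtain r where "(\<integral>\<^sup>+z. gibbs_density \<epsilon> c u v z \<partial>R) = ennreal r" "r \<ge> 0"
    using nn_integral_gibbs_less_top[OF u v]
    by (cases "\<integral>\<^sup>+z. gibbs_density \<epsilon> c u v z \<partial>R" rule: ennreal_cases) auto
  then have "\<bar>ext_integral \<rho>\<^sub>1 u\<bar> \<noteq> \<infinity>" "\<bar>ext_integral \<rho>\<^sub>2 v\<bar> \<noteq> \<infinity>"
    using fin top
    by (cases "ext_integral \<rho>\<^sub>1 u"; cases "ext_integral \<rho>\<^sub>2 v"; simp add: dual_functional_def)+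
  then show thesis
    using LexpD(1)[OF u] LexpD(1)[OF v] by (intro that) (rule ext_integral_finiteD; assumption)+
qed

text \<open>A function of the form \<open>a (fst z) + b (snd z)\<close> sees a coupling only through
  its marginals, by change of variables.\<close>

lemma coupling_integral:
  assumes \<gamma>: "\<gamma> \<in> couplings \<rho>\<^sub>1 \<rho>\<^sub>2" "\<gamma> = density R (\<lambda>z. ennreal (g z))"
    and [measurable]: "g \<in> borel_measurable R" and g: "\<And>z. g z \<ge> (0::real)"
    and a: "integrable \<rho>\<^sub>1 a" and b: "integrable \<rho>\<^sub>2 b"
  shows "integrable R g" "(\<integral>z. g z \<partial>R) = 1"
    "integrable R (\<lambda>z. g z * (a (fst z) + b (snd z)))"
    "(\<integral>z. g z * (a (fst z) + b (snd z)) \<partial>R) = (\<integral>x. a x \<partial>\<rho>\<^sub>1) + (\<integral>y. b y \<partial>\<rho>\<^sub>2)"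
proof -
  note [measurable] = borel_measurable_integrable[OF a] borel_measurable_integrable[OF b]
  interpret \<gamma>: prob_space \<gamma> using \<gamma>(1) by (simp add: couplings_def)
  have m1: "distr \<gamma> borel fst = \<rho>\<^sub>1" and m2: "distr \<gamma> borel snd = \<rho>\<^sub>2"
    using \<gamma>(1) by (auto simp: couplings_def)
  have [measurable]: "fst \<in> measurable \<gamma> borel" "snd \<in> measurable \<gamma> borel"
    "a \<in> borel_measurable borel" "b \<in> borel_measurable borel"
    using borel_measurable_integrable[OF a] borel_measurable_integrable[OF b]
    by (simp_all add: \<gamma>(2))
  have "integrable \<gamma> (\<lambda>_. 1::real)" by simp
  then show "integrable R g"
    unfolding \<gamma>(2) using g by (subst (asm) integrable_density) auto
  have "(\<integral>z. g z *\<^sub>R 1 \<partial>R) = (\<integral>z. (1::real) \<partial>\<gamma>)"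
    unfolding \<gamma>(2) by (rule integral_density[symmetric]) (use g in auto)
  then show "(\<integral>z. g z \<partial>R) = 1" by (simp add: \<gamma>.prob_space)
  have ia: "integrable \<gamma> (\<lambda>z. a (fst z))"
    by (rule integrable_distr[of fst _ borel]) (simp_all add: m1 a)
  have ib: "integrable \<gamma> (\<lambda>z. b (snd z))"
    by (rule integrable_distr[of snd _ borel]) (simp_all add: m2 b)
  have "(\<integral>z. a (fst z) \<partial>\<gamma>) = (\<integral>x. a x \<partial>distr \<gamma> borel fst)"
    "(\<integral>z. b (snd z) \<partial>\<gamma>) = (\<integral>y. b y \<partial>distr \<gamma> borel snd)"
    by (simp_all add: integral_distr)
  then have "integrable \<gamma> (\<lambda>z. a (fst z) + b (snd z))"
    "(\<integral>z. a (fst z) + b (snd z) \<partial>\<gamma>) = (\<integral>x. a x \<partial>\<rho>\<^sub>1) + (\<integral>y. b y \<partial>\<rho>\<^sub>2)"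
    using ia ib by (simp_all add: m1 m2)
  then show "integrable R (\<lambda>z. g z * (a (fst z) + b (snd z)))"
    "(\<integral>z. g z * (a (fst z) + b (snd z)) \<partial>R) = (\<integral>x. a x \<partial>\<rho>\<^sub>1) + (\<integral>y. b y \<partial>\<rho>\<^sub>2)"
    unfolding \<gamma>(2) using g by (simp_all add: integrable_density integral_density)
qed

section \<open>Duality gap and weak duality\<close>

lemma integrable_kernel: "integrable R (\<lambda>z. exp (- c z / \<epsilon>))"
proof -
  obtain C where C: "\<bar>c z\<bar> \<le> C" for z
    using c_bounded by (auto simp: bounded_iff)
  have "- c z \<le> C" for z using C[of z] by auto
  note cb = this[THEN divide_right_mono, of \<epsilon>]
  show ?thesis
    using cb eps_pos by (intro integrable_const_bound[where B = "exp (C / \<epsilon>)"]) auto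
qed

text \<open>The gap is \<open>\<epsilon>\<close> times the integral of the nonnegative function
  \<open>\<psi>\<close> below. It vanishes only if \<open>\<psi>\<close> is zero a.e., that is, if
  the density of \<open>\<gamma>\<close> is the Gibbs density a.e.\<close>

lemma duality_gap:
  assumes u: "u \<in> Lexp \<epsilon> \<rho>\<^sub>1" and v: "v \<in> Lexp \<epsilon> \<rho>\<^sub>2" and \<gamma>: "\<gamma> \<in> couplings \<rho>\<^sub>1 \<rho>\<^sub>2"
    and D: "dual_functional \<epsilon> c \<rho>\<^sub>1 \<rho>\<^sub>2 u v \<noteq> -\<infinity>"
    and fin: "KL R (\<lambda>z. exp (- c z / \<epsilon>)) \<gamma> \<noteq> \<infinity>"
  shows "dual_functional \<epsilon> c \<rho>\<^sub>1 \<rho>\<^sub>2 u v + ereal \<epsilon> \<le> entropic_cost \<epsilon> c \<rho>\<^sub>1 \<rho>\<^sub>2 \<gamma>"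
    and "entropic_cost \<epsilon> c \<rho>\<^sub>1 \<rho>\<^sub>2 \<gamma> = dual_functional \<epsilon> c \<rho>\<^sub>1 \<rho>\<^sub>2 u v + ereal \<epsilon> \<Longrightarrow>
      \<gamma> = density R (gibbs_density \<epsilon> c u v)"
proof -
  note [measurable] = LexpD(1)[OF u] LexpD(1)[OF v]
  obtain a b where a: "integrable \<rho>\<^sub>1 a" and b: "integrable \<rho>\<^sub>2 b"
    and ua: "AE x in \<rho>\<^sub>1. u x = ereal (a x)" and vb: "AE y in \<rho>\<^sub>2. v y = ereal (b y)"
    by (rule dual_functional_finiteD[OF u v D])
  define k h where "k z = exp (- c z / \<epsilon>)" and "h z = exp ((a (fst z) + b (snd z) - c z) / \<epsilon>)" for z
  note h = dual_functional_real[OF u v a b ua vb, folded h_def]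
  have "finite_measure \<gamma>" "sets \<gamma> = sets R"
    using \<gamma> by (auto simp: couplings_def sets_R prob_space_def)
  then obtain g where g[measurable]: "g \<in> borel_measurable R" and g0: "\<And>z. g z \<ge> (0::real)"
    and \<gamma>g: "\<gamma> = density R (\<lambda>z. ennreal (g z))" and \<phi>: "integrable R (\<lambda>z. g z * ln (g z / k z))"
    and KL: "KL R k \<gamma> = ereal (\<integral>z. g z * ln (g z / k z) \<partial>R)"
    unfolding k_def by (rule P.KL_finiteD[OF _ _ integrable_kernel _ fin]) auto
  note ci = coupling_integral[OF \<gamma> \<gamma>g g g0 a b]
  have [measurable]: "h \<in> borel_measurable R" using h(2) by simp
  define \<psi> where "\<psi> z = g z * ln (g z / h z) - (g z - h z)" for z
  \<comment> \<open>Here \<open>ln h = ln k + (a + b) / \<epsilon>\<close> separates the entropy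
    from the potentials; where \<open>g\<close> vanishes both sides equal \<open>h\<close>.\<close>
  have \<psi>: "\<psi> z = g z * ln (g z / k z) - g z * (a (fst z) + b (snd z)) / \<epsilon> - g z + h z" for z
  proof (cases "g z = 0")
    case False
    then have "g z > 0" using g0[of z] by simp
    then have "ln (g z / h z) = ln (g z / k z) - (a (fst z) + b (snd z)) / \<epsilon>"
      by (simp add: ln_div h_def k_def diff_divide_distrib add_divide_distrib)
    then show ?thesis by (simp only: \<psi>_def) (simp add: right_diff_distrib)
  qed (simp add: \<psi>_def)
  have \<psi>0: "\<psi> z \<ge> 0" for z
    using mult_ln_divide_ge(1)[OF g0, of "h z" z] by (simp add: \<psi>_def h_def)
  have \<psi>int: "integrable R \<psi>"
    unfolding \<psi>[abs_def] using \<phi> ci h(2) by (intro Bochner_Integration.integrable_add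
      Bochner_Integration.integrable_diff integrable_divide)
  \<comment> \<open>The 1 is the mass of the coupling; multiplied by \<open>\<epsilon>\<close> it
    becomes the additive \<open>\<epsilon>\<close> in the duality relation.\<close>
  have \<psi>I: "(\<integral>z. \<psi> z \<partial>R) = (\<integral>z. g z * ln (g z / k z) \<partial>R)
      - ((\<integral>x. a x \<partial>\<rho>\<^sub>1) + (\<integral>y. b y \<partial>\<rho>\<^sub>2)) / \<epsilon> - 1 + (\<integral>z. h z \<partial>R)"
    unfolding \<psi> using \<phi> ci h(2) by simp
  have cost: "entropic_cost \<epsilon> c \<rho>\<^sub>1 \<rho>\<^sub>2 \<gamma> = dual_functional \<epsilon> c \<rho>\<^sub>1 \<rho>\<^sub>2 u v + ereal \<epsilon> + ereal (\<epsilon> * (\<integral>z. \<psi> z \<partial>R))"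
    unfolding entropic_cost_def k_def[symmetric, abs_def] KL h(3) \<psi>I
    using eps_pos by (simp add: field_simps)
  have "0 \<le> \<epsilon> * (\<integral>z. \<psi> z \<partial>R)" using eps_pos \<psi>0 by simp
  then show "dual_functional \<epsilon> c \<rho>\<^sub>1 \<rho>\<^sub>2 u v + ereal \<epsilon> \<le> entropic_cost \<epsilon> c \<rho>\<^sub>1 \<rho>\<^sub>2 \<gamma>"
    unfolding cost h(3) by simp
  assume "entropic_cost \<epsilon> c \<rho>\<^sub>1 \<rho>\<^sub>2 \<gamma> = dual_functional \<epsilon> c \<rho>\<^sub>1 \<rho>\<^sub>2 u v + ereal \<epsilon>"
  then have "(\<integral>z. \<psi> z \<partial>R) = 0"
    unfolding cost h(3) using eps_pos by simp
  then have "AE z in R. \<psi> z = 0"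
    using integral_nonneg_eq_0_iff_AE[OF \<psi>int] \<psi>0 by simp
  with h(1) have "AE z in R. ennreal (g z) = gibbs_density \<epsilon> c u v z"
  proof eventually_elim
    case (elim z)
    then show ?case
      using mult_ln_divide_ge(2)[OF g0, of "h z" z] by (simp add: \<psi>_def h_def)
  qed
  then show "\<gamma> = density R (gibbs_density \<epsilon> c u v)"
    unfolding \<gamma>g by (intro density_cong) auto
qed

text \<open>In the cases outside the gap computation, the left side is \<open>-\<infinity>\<close>
  or the right side is \<open>\<infinity>\<close>.\<close>

lemma weak_duality:
  assumes u: "u \<in> Lexp \<epsilon> \<rho>\<^sub>1" and v: "v \<in> Lexp \<epsilon> \<rho>\<^sub>2" and \<gamma>: "\<gamma> \<in> couplings \<rho>\<^sub>1 \<rho>\<^sub>2"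
  shows "dual_functional \<epsilon> c \<rho>\<^sub>1 \<rho>\<^sub>2 u v + ereal \<epsilon> \<le> entropic_cost \<epsilon> c \<rho>\<^sub>1 \<rho>\<^sub>2 \<gamma>"
proof (cases "dual_functional \<epsilon> c \<rho>\<^sub>1 \<rho>\<^sub>2 u v = -\<infinity> \<or> KL R (\<lambda>z. exp (- c z / \<epsilon>)) \<gamma> = \<infinity>")
  case False
  then show ?thesis using duality_gap(1)[OF u v \<gamma>] by simp
qed (use eps_pos in \<open>auto simp: entropic_cost_def\<close>)

lemma weak_duality_OT:
  assumes "u \<in> Lexp \<epsilon> \<rho>\<^sub>1" "v \<in> Lexp \<epsilon> \<rho>\<^sub>2"
  shows "dual_functional \<epsilon> c \<rho>\<^sub>1 \<rho>\<^sub>2 u v + ereal \<epsilon> \<le> OT \<epsilon> c \<rho>\<^sub>1 \<rho>\<^sub>2"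
  unfolding OT_def using weak_duality[OF assms] by (intro INF_greatest)

text \<open>The transform equations make \<open>u\<close> and \<open>v\<close> a.e. equal to bounded
  functions, so every integral is finite. Having mass 1, the Gibbs measure contributes
  \<open>- \<epsilon>\<close> to the dual functional, which the added \<open>\<epsilon>\<close>
  cancels; both sides are then the sum of the integrals of the potentials.\<close>

lemma gibbs_coupling_cost:
  assumes u: "u \<in> Lexp \<epsilon> \<rho>\<^sub>1" and v: "v \<in> Lexp \<epsilon> \<rho>\<^sub>2"
    and \<gamma>: "density R (gibbs_density \<epsilon> c u v) \<in> couplings \<rho>\<^sub>1 \<rho>\<^sub>2"
  shows "dual_functional \<epsilon> c \<rho>\<^sub>1 \<rho>\<^sub>2 u v \<noteq> -\<infinity>"
    and "entropic_cost \<epsilon> c \<rho>\<^sub>1 \<rho>\<^sub>2 (density R (gibbs_density \<epsilon> c u v))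
      = dual_functional \<epsilon> c \<rho>\<^sub>1 \<rho>\<^sub>2 u v + ereal \<epsilon>"
proof -
  interpret S: entropic_transport \<epsilon> "c \<circ> prod.swap" \<rho>\<^sub>2 \<rho>\<^sub>1 by (rule entropic_transport_swap)
  note [measurable] = LexpD(1)[OF u] LexpD(1)[OF v]
  obtain a A where a: "a \<in> borel_measurable borel" "\<And>x. \<bar>a x\<bar> \<le> (A::real)"
    "\<And>x. transform2 \<epsilon> c \<rho>\<^sub>2 v x = ereal (a x)"
    by (rule S.transform1_real[OF v, unfolded transform1_swap]) blast
  obtain b B where b: "b \<in> borel_measurable borel" "\<And>y. \<bar>b y\<bar> \<le> (B::real)"
    "\<And>y. transform1 \<epsilon> c \<rho>\<^sub>1 u y = ereal (b y)"
    by (rule transform1_real[OF u]) blast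
  have ua: "AE x in \<rho>\<^sub>1. u x = ereal (a x)" and vb: "AE y in \<rho>\<^sub>2. v y = ereal (b y)"
    using \<gamma> unfolding gibbs_coupling_iff[OF u v] a b by (auto elim!: eventually_mono)
  have ai: "integrable \<rho>\<^sub>1 a" and bi: "integrable \<rho>\<^sub>2 b"
    using a b by (auto intro!: M1.integrable_const_bound[where B = A] M2.integrable_const_bound[where B = B])
  define k h where "k z = exp (- c z / \<epsilon>)" and "h z = exp ((a (fst z) + b (snd z) - c z) / \<epsilon>)" for z
  note h = dual_functional_real[OF u v ai bi ua vb, folded h_def]
  have [measurable]: "h \<in> borel_measurable R" using h(2) by simp
  have h0: "h z \<ge> 0" for z by (simp add: h_def)
  show "dual_functional \<epsilon> c \<rho>\<^sub>1 \<rho>\<^sub>2 u v \<noteq> -\<infinity>" using h(3) by simp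
  have eq: "density R (gibbs_density \<epsilon> c u v) = density R (\<lambda>z. ennreal (h z))"
    using h(1) by (intro density_cong) auto
  note ci = coupling_integral[OF \<gamma> eq _ h0 ai bi]
  \<comment> \<open>The cost \<open>c\<close> cancels in the quotient, leaving only the potentials,
    which the marginals integrate.\<close>
  have \<phi>: "h z * ln (h z / k z) = h z * (a (fst z) + b (snd z)) / \<epsilon>" for z
    by (simp add: h_def k_def ln_div diff_divide_distrib)
  have "KL R k (density R (\<lambda>z. ennreal (h z))) = ereal (\<integral>z. h z * ln (h z / k z) \<partial>R)"
    by (rule P.KL_density) (use h0 ci(3) in \<open>auto simp: \<phi>\<close>)
  also have "(\<integral>z. h z * ln (h z / k z) \<partial>R) = ((\<integral>x. a x \<partial>\<rho>\<^sub>1) + (\<integral>y. b y \<partial>\<rho>\<^sub>2)) / \<epsilon>"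
    unfolding \<phi> using ci(4) by simp
  finally have KL: "KL R (\<lambda>z. exp (- c z / \<epsilon>)) (density R (\<lambda>z. ennreal (h z)))
      = ereal (((\<integral>x. a x \<partial>\<rho>\<^sub>1) + (\<integral>y. b y \<partial>\<rho>\<^sub>2)) / \<epsilon>)"
    by (simp add: k_def[abs_def])
  have "(\<integral>z. h z \<partial>R) = 1" using ci(2) by simp
  then show "entropic_cost \<epsilon> c \<rho>\<^sub>1 \<rho>\<^sub>2 (density R (gibbs_density \<epsilon> c u v))
      = dual_functional \<epsilon> c \<rho>\<^sub>1 \<rho>\<^sub>2 u v + ereal \<epsilon>"
    unfolding entropic_cost_def eq KL h(3) using eps_pos by simp
qed

text \<open>For fixed \<open>u\<close>, writing \<open>f\<close> for the transform of \<open>u\<close> and \<open>w = (v - f)/\<epsilon>\<close>, the dual functional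
  at \<open>v\<close> falls short of its value at \<open>f\<close> by \<open>\<epsilon> \<integral>(exp w - 1 - w)\<close>.\<close>

lemma maximizer_transform1:
  assumes u: "u \<in> Lexp \<epsilon> \<rho>\<^sub>1" and v: "v \<in> Lexp \<epsilon> \<rho>\<^sub>2"
    and D: "dual_functional \<epsilon> c \<rho>\<^sub>1 \<rho>\<^sub>2 u v \<noteq> -\<infinity>"
    and max: "\<And>v'. v' \<in> Lexp \<epsilon> \<rho>\<^sub>2 \<Longrightarrow> dual_functional \<epsilon> c \<rho>\<^sub>1 \<rho>\<^sub>2 u v' \<le> dual_functional \<epsilon> c \<rho>\<^sub>1 \<rho>\<^sub>2 u v"
  shows "AE y in \<rho>\<^sub>2. transform1 \<epsilon> c \<rho>\<^sub>1 u y = v y"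
proof -
  obtain f B where f: "f \<in> borel_measurable borel" "\<And>y. \<bar>f y\<bar> \<le> (B::real)"
    "\<And>y. partition_function u y = ennreal (exp (- f y / \<epsilon>))" "\<And>y. transform1 \<epsilon> c \<rho>\<^sub>1 u y = ereal (f y)"
    by (rule transform1_real[OF u]) blast
  have [measurable]: "f \<in> borel_measurable \<rho>\<^sub>2" using f(1) by simp
  have fL: "(\<lambda>y. ereal (f y)) \<in> Lexp \<epsilon> \<rho>\<^sub>2"
    using eps_pos f(2) by (intro M2.bounded_in_Lexp) auto
  have fi: "integrable \<rho>\<^sub>2 f"
    using f(2) by (intro M2.integrable_const_bound[where B = B]) auto
  obtain a b where a: "integrable \<rho>\<^sub>1 a" and b: "integrable \<rho>\<^sub>2 b"
    and ua: "AE x in \<rho>\<^sub>1. u x = ereal (a x)" and vb: "AE y in \<rho>\<^sub>2. v y = ereal (b y)"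
    by (rule dual_functional_finiteD[OF u v D])
  note [measurable] = borel_measurable_integrable[OF a] borel_measurable_integrable[OF b]
  \<comment> \<open>With \<open>u\<close> fixed and \<open>exp (- f / \<epsilon>)\<close> as its
    partition function, the Gibbs mass becomes an integral over the second factor alone. The
    potential \<open>v'\<close> is arbitrary since both \<open>v\<close> and the competitor
    \<open>f\<close> are inserted below.\<close>
  have mass: "integrable \<rho>\<^sub>2 (\<lambda>y. exp ((b' y - f y) / \<epsilon>))"
    "dual_functional \<epsilon> c \<rho>\<^sub>1 \<rho>\<^sub>2 u v'
      = ereal ((\<integral>x. a x \<partial>\<rho>\<^sub>1) + (\<integral>y. b' y \<partial>\<rho>\<^sub>2) - \<epsilon> * (\<integral>y. exp ((b' y - f y) / \<epsilon>) \<partial>\<rho>\<^sub>2))"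
    if v': "v' \<in> Lexp \<epsilon> \<rho>\<^sub>2" and b': "integrable \<rho>\<^sub>2 b'" and vb': "AE y in \<rho>\<^sub>2. v' y = ereal (b' y)"
    for v' b'
  proof -
    note [measurable] = borel_measurable_integrable[OF b']
    note h = dual_functional_real[OF u v' a b' ua vb']
    let ?h = "\<lambda>z. exp ((a (fst z) + b' (snd z) - c z) / \<epsilon>)"
    have "(\<integral>\<^sup>+y. ennreal (exp ((b' y - f y) / \<epsilon>)) \<partial>\<rho>\<^sub>2)
        = (\<integral>\<^sup>+y. eexp (v' y / ereal \<epsilon>) * partition_function u y \<partial>\<rho>\<^sub>2)"
    proof (rule nn_integral_cong_AE, use vb' in eventually_elim)
      case (elim y)
      show ?case
        using eps_pos
        by (simp add: elim f(3) ennreal_mult[symmetric] exp_add[symmetric] diff_divide_distrib)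
    qed
    also have "\<dots> = (\<integral>\<^sup>+z. ennreal (?h z) \<partial>R)"
      unfolding nn_integral_gibbs[OF u v', symmetric] using h(1) by (rule nn_integral_cong_AE)
    also have "\<dots> = ennreal (\<integral>z. ?h z \<partial>R)"
      by (rule nn_integral_eq_integral[OF h(2)]) simp
    finally have *: "(\<integral>\<^sup>+y. ennreal (exp ((b' y - f y) / \<epsilon>)) \<partial>\<rho>\<^sub>2) = ennreal (\<integral>z. ?h z \<partial>R)" .
    then show "integrable \<rho>\<^sub>2 (\<lambda>y. exp ((b' y - f y) / \<epsilon>))"
      by (intro integrableI_nonneg) auto
    have "(\<integral>y. exp ((b' y - f y) / \<epsilon>) \<partial>\<rho>\<^sub>2) = (\<integral>z. ?h z \<partial>R)"
      by (rule integral_eq_nn_integral[THEN trans]) (auto simp: *)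
    then show "dual_functional \<epsilon> c \<rho>\<^sub>1 \<rho>\<^sub>2 u v'
      = ereal ((\<integral>x. a x \<partial>\<rho>\<^sub>1) + (\<integral>y. b' y \<partial>\<rho>\<^sub>2) - \<epsilon> * (\<integral>y. exp ((b' y - f y) / \<epsilon>) \<partial>\<rho>\<^sub>2))"
      using h(3) by simp
  qed
  define w where "w y = (b y - f y) / \<epsilon>" for y
  have wi: "integrable \<rho>\<^sub>2 w" and wI: "(\<integral>y. w y \<partial>\<rho>\<^sub>2) = ((\<integral>y. b y \<partial>\<rho>\<^sub>2) - (\<integral>y. f y \<partial>\<rho>\<^sub>2)) / \<epsilon>"
    unfolding w_def using b fi by simp_all
  have ei: "integrable \<rho>\<^sub>2 (\<lambda>y. exp (w y))"
    unfolding w_def by (rule mass(1)[OF v b vb])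
  \<comment> \<open>Maximality is tested against \<open>f\<close>, for which the exponential is
    constantly 1 and its term is \<open>\<epsilon>\<close>.\<close>
  have "(\<integral>y. f y \<partial>\<rho>\<^sub>2) - \<epsilon> \<le> (\<integral>y. b y \<partial>\<rho>\<^sub>2) - \<epsilon> * (\<integral>y. exp (w y) \<partial>\<rho>\<^sub>2)"
    using max[OF fL] unfolding mass(2)[OF fL fi AE_I2[OF refl]] mass(2)[OF v b vb] w_def
    by (simp add: M2.prob_space)
  moreover have "\<epsilon> * (\<integral>y. w y \<partial>\<rho>\<^sub>2) = (\<integral>y. b y \<partial>\<rho>\<^sub>2) - (\<integral>y. f y \<partial>\<rho>\<^sub>2)"
    unfolding wI using eps_pos by simp
  ultimately have "\<epsilon> * ((\<integral>y. exp (w y) \<partial>\<rho>\<^sub>2) - 1 - (\<integral>y. w y \<partial>\<rho>\<^sub>2)) \<le> 0"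
    unfolding right_diff_distrib by linarith
  then have "(\<integral>y. exp (w y) - 1 - w y \<partial>\<rho>\<^sub>2) \<le> 0"
    using eps_pos ei wi by (simp add: mult_le_0_iff M2.prob_space)
  moreover have nn: "0 \<le> exp (w y) - 1 - w y" for y
    using exp_ge_add_one_self[of "w y"] by linarith
  moreover have i: "integrable \<rho>\<^sub>2 (\<lambda>y. exp (w y) - 1 - w y)" using ei wi by simp
  ultimately have "(\<integral>y. exp (w y) - 1 - w y \<partial>\<rho>\<^sub>2) = 0"
    by (intro antisym) auto
  then have "AE y in \<rho>\<^sub>2. exp (w y) - 1 - w y = 0"
    using integral_nonneg_eq_0_iff_AE[OF i] nn by simp
  with vb show ?thesis
  proof eventually_elim
    case (elim y)
    \<comment> \<open>Equality in \<open>1 + w \<le> exp w\<close> is equality in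
      \<open>ln t \<le> t - 1\<close> at \<open>t = exp w\<close>, so \<open>w = 0\<close>.\<close>
    have "ln (exp (w y)) = exp (w y) - 1" using elim by simp
    then have "exp (w y) = 1" by (rule ln_eq_minus_one[rotated]) simp
    then show ?case using elim(1) eps_pos by (simp add: w_def f(4))
  qed
qed

text \<open>A competitor with value above \<open>-\<infinity>\<close>, which keeps the value at any
  maximizing pair away from \<open>-\<infinity>\<close>.\<close>

lemma dual_functional_zero_finite:
  "(\<lambda>_. 0) \<in> Lexp \<epsilon> \<rho>\<^sub>1" "(\<lambda>_. 0) \<in> Lexp \<epsilon> \<rho>\<^sub>2"
  "dual_functional \<epsilon> c \<rho>\<^sub>1 \<rho>\<^sub>2 (\<lambda>_. 0) (\<lambda>_. 0) \<noteq> -\<infinity>"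
proof -
  show *: "(\<lambda>_. 0) \<in> Lexp \<epsilon> \<rho>\<^sub>1" "(\<lambda>_. 0) \<in> Lexp \<epsilon> \<rho>\<^sub>2"
    using M1.bounded_in_Lexp[of "\<lambda>_. 0" \<epsilon> 0] M2.bounded_in_Lexp[of "\<lambda>_. 0" \<epsilon> 0] eps_pos
    by (auto simp: zero_ereal_def)
  show "dual_functional \<epsilon> c \<rho>\<^sub>1 \<rho>\<^sub>2 (\<lambda>_. 0) (\<lambda>_. 0) \<noteq> -\<infinity>"
    using dual_functional_real(3)[OF *, of "\<lambda>_. 0" "\<lambda>_. 0"] by simp
qed

lemma maximizer_imp_transforms:
  assumes u: "u \<in> Lexp \<epsilon> \<rho>\<^sub>1" and v: "v \<in> Lexp \<epsilon> \<rho>\<^sub>2"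
    and max: "\<And>u' v'. u' \<in> Lexp \<epsilon> \<rho>\<^sub>1 \<Longrightarrow> v' \<in> Lexp \<epsilon> \<rho>\<^sub>2 \<Longrightarrow>
      dual_functional \<epsilon> c \<rho>\<^sub>1 \<rho>\<^sub>2 u' v' \<le> dual_functional \<epsilon> c \<rho>\<^sub>1 \<rho>\<^sub>2 u v"
  shows "AE y in \<rho>\<^sub>2. transform1 \<epsilon> c \<rho>\<^sub>1 u y = v y" "AE x in \<rho>\<^sub>1. transform2 \<epsilon> c \<rho>\<^sub>2 v x = u x"
proof -
  interpret S: entropic_transport \<epsilon> "c \<circ> prod.swap" \<rho>\<^sub>2 \<rho>\<^sub>1 by (rule entropic_transport_swap)
  have D: "dual_functional \<epsilon> c \<rho>\<^sub>1 \<rho>\<^sub>2 u v \<noteq> -\<infinity>"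
    using max[OF dual_functional_zero_finite(1,2)] dual_functional_zero_finite(3) by auto
  show "AE y in \<rho>\<^sub>2. transform1 \<epsilon> c \<rho>\<^sub>1 u y = v y"
    using D max u v by (intro maximizer_transform1) auto
  \<comment> \<open>In the exchanged problem \<open>v\<close> is the fixed potential and
    \<open>u\<close> the varied one.\<close>
  have "AE x in \<rho>\<^sub>1. transform1 \<epsilon> (c \<circ> prod.swap) \<rho>\<^sub>2 v x = u x"
    using D max u v by (intro S.maximizer_transform1) (auto simp: dual_functional_swap)
  then show "AE x in \<rho>\<^sub>1. transform2 \<epsilon> c \<rho>\<^sub>2 v x = u x"
    by (simp add: transform1_swap)
qed

end

section \<open>The four equivalences and uniqueness of the minimizer\<close>

theorem proposition2p11:
  fixes \<epsilon> :: real
    and c :: "'a::polish_space \<times> 'b::polish_space \<Rightarrow> real"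
    and \<rho>\<^sub>1 :: "'a measure" and \<rho>\<^sub>2 :: "'b measure"
    and us :: "'a \<Rightarrow> ereal" and vs :: "'b \<Rightarrow> ereal"
  assumes "\<epsilon> > 0"
    and "c \<in> borel_measurable borel" and "bounded (range c)"
    and "prob_space \<rho>\<^sub>1" and "sets \<rho>\<^sub>1 = sets borel"
    and "prob_space \<rho>\<^sub>2" and "sets \<rho>\<^sub>2 = sets borel"
    and "us \<in> Lexp \<epsilon> \<rho>\<^sub>1" and "vs \<in> Lexp \<epsilon> \<rho>\<^sub>2"
  shows
    "let \<gamma> = density (\<rho>\<^sub>1 \<Otimes>\<^sub>M \<rho>\<^sub>2) (gibbs_density \<epsilon> c us vs);
         maximizers = (dual_functional \<epsilon> c \<rho>\<^sub>1 \<rho>\<^sub>2 us vs =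
           (SUP (u, v) \<in> Lexp \<epsilon> \<rho>\<^sub>1 \<times> Lexp \<epsilon> \<rho>\<^sub>2. dual_functional \<epsilon> c \<rho>\<^sub>1 \<rho>\<^sub>2 u v));
         maximality = ((AE y in \<rho>\<^sub>2. transform1 \<epsilon> c \<rho>\<^sub>1 us y = vs y) \<and>
           (AE x in \<rho>\<^sub>1. transform2 \<epsilon> c \<rho>\<^sub>2 vs x = us x));
         schroedinger = (\<gamma> \<in> couplings \<rho>\<^sub>1 \<rho>\<^sub>2);
         attainment = (OT \<epsilon> c \<rho>\<^sub>1 \<rho>\<^sub>2 = dual_functional \<epsilon> c \<rho>\<^sub>1 \<rho>\<^sub>2 us vs + ereal \<epsilon>)
     in (maximizers \<longleftrightarrow> maximality) \<and> (maximality \<longleftrightarrow> schroedinger) \<and>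
        (schroedinger \<longleftrightarrow> attainment) \<and>
        (maximizers \<longrightarrow>
          {\<gamma>' \<in> couplings \<rho>\<^sub>1 \<rho>\<^sub>2. entropic_cost \<epsilon> c \<rho>\<^sub>1 \<rho>\<^sub>2 \<gamma>' = OT \<epsilon> c \<rho>\<^sub>1 \<rho>\<^sub>2} = {\<gamma>})"
proof -
  interpret entropic_transport \<epsilon> c \<rho>\<^sub>1 \<rho>\<^sub>2 by (intro entropic_transport.intro assms)
  note u = \<open>us \<in> Lexp \<epsilon> \<rho>\<^sub>1\<close> and v = \<open>vs \<in> Lexp \<epsilon> \<rho>\<^sub>2\<close>
  let ?D = "dual_functional \<epsilon> c \<rho>\<^sub>1 \<rho>\<^sub>2" and ?OT = "OT \<epsilon> c \<rho>\<^sub>1 \<rho>\<^sub>2" and ?cost = "entropic_cost \<epsilon> c \<rho>\<^sub>1 \<rho>\<^sub>2"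
  let ?\<gamma> = "density R (gibbs_density \<epsilon> c us vs)"
  let ?max = "?D us vs = (SUP (u, v) \<in> Lexp \<epsilon> \<rho>\<^sub>1 \<times> Lexp \<epsilon> \<rho>\<^sub>2. ?D u v)"
  let ?sys = "(AE y in \<rho>\<^sub>2. transform1 \<epsilon> c \<rho>\<^sub>1 us y = vs y) \<and> (AE x in \<rho>\<^sub>1. transform2 \<epsilon> c \<rho>\<^sub>2 vs x = us x)"
  \<comment> \<open>The implications run in a cycle: maximizers, transform equations, coupling,
    attainment, and back to maximizers.\<close>
  have 12: ?sys if ?max
  proof -
    have "?D u' v' \<le> ?D us vs" if "u' \<in> Lexp \<epsilon> \<rho>\<^sub>1" "v' \<in> Lexp \<epsilon> \<rho>\<^sub>2" for u' v'
      unfolding \<open>?max\<close> using that by (intro SUP_upper2[of "(u', v')"]) auto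
    then show ?thesis using maximizer_imp_transforms[OF u v] by blast
  qed
  have 23: "?sys \<longleftrightarrow> ?\<gamma> \<in> couplings \<rho>\<^sub>1 \<rho>\<^sub>2"
    using gibbs_coupling_iff[OF u v] by simp
  have 34: "?OT = ?D us vs + ereal \<epsilon>" if "?\<gamma> \<in> couplings \<rho>\<^sub>1 \<rho>\<^sub>2"
  proof (rule antisym)
    show "?OT \<le> ?D us vs + ereal \<epsilon>"
      unfolding OT_def gibbs_coupling_cost(2)[OF u v that, symmetric] using that by (rule INF_lower)
  qed (rule weak_duality_OT[OF u v])
  have 41: ?max if "?OT = ?D us vs + ereal \<epsilon>"
  proof (rule antisym)
    show "?D us vs \<le> (SUP (u, v) \<in> Lexp \<epsilon> \<rho>\<^sub>1 \<times> Lexp \<epsilon> \<rho>\<^sub>2. ?D u v)"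
      using u v by (intro SUP_upper2[of "(us, vs)"]) auto
    \<comment> \<open>Weak duality bounds every dual value plus \<open>\<epsilon>\<close> by the
      attained cost; the finite \<open>\<epsilon>\<close> cancels on both sides, also at infinite
      values.\<close>
    have "?D u' v' \<le> ?D us vs" if "u' \<in> Lexp \<epsilon> \<rho>\<^sub>1" "v' \<in> Lexp \<epsilon> \<rho>\<^sub>2" for u' v'
      using weak_duality_OT[OF that] unfolding \<open>?OT = _\<close>
      by (cases "?D u' v'"; cases "?D us vs") auto
    then show "(SUP (u, v) \<in> Lexp \<epsilon> \<rho>\<^sub>1 \<times> Lexp \<epsilon> \<rho>\<^sub>2. ?D u v) \<le> ?D us vs"
      by (intro SUP_least) auto
  qed
  have "{\<gamma>' \<in> couplings \<rho>\<^sub>1 \<rho>\<^sub>2. ?cost \<gamma>' = ?OT} = {?\<gamma>}" if ?max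
  proof -
    have \<gamma>: "?\<gamma> \<in> couplings \<rho>\<^sub>1 \<rho>\<^sub>2" using 12 23 that by blast
    note OT = 34[OF \<gamma>] and D = gibbs_coupling_cost(1)[OF u v \<gamma>]
    \<comment> \<open>Finiteness of the dual value makes the optimal cost finite, so every minimizer
      has finite entropy and the equality case of the duality gap applies.\<close>
    obtain d where d: "?D us vs = ereal d"
      using dual_functional_finiteD[OF u v D] dual_functional_real(3)[OF u v] by metis
    have "\<gamma>' = ?\<gamma>" if \<gamma>': "\<gamma>' \<in> couplings \<rho>\<^sub>1 \<rho>\<^sub>2" "?cost \<gamma>' = ?OT" for \<gamma>'
    proof (rule duality_gap(2)[OF u v \<gamma>'(1) D])
      show "KL R (\<lambda>z. exp (- c z / \<epsilon>)) \<gamma>' \<noteq> \<infinity>"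
        using \<gamma>'(2) \<open>\<epsilon> > 0\<close> by (auto simp: entropic_cost_def OT d)
    qed (use \<gamma>'(2) OT in simp)
    moreover have "?cost ?\<gamma> = ?OT"
      unfolding OT by (rule gibbs_coupling_cost(2)[OF u v \<gamma>])
    ultimately show ?thesis using \<gamma> by blast
  qed
  moreover have "?max \<longleftrightarrow> ?sys" "?sys \<longleftrightarrow> ?\<gamma> \<in> couplings \<rho>\<^sub>1 \<rho>\<^sub>2"
    "?\<gamma> \<in> couplings \<rho>\<^sub>1 \<rho>\<^sub>2 \<longleftrightarrow> ?OT = ?D us vs + ereal \<epsilon>"
    using 12 23 34 41 by argo+
  ultimately show ?thesis unfolding Let_def by (intro conjI impI)
qed

end
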